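(* For a finite tree $T$ on $n = |V(T)|$ vertices, let $$s_9(T) = \sqrt{n-1} - n + 1 - \lambda_1(T) + \alpha(T),$$ where $\lambda_1(T)$ is the largest eigenvalue of the adjacency matrix of $T$ and $\alpha(T)$ is the independence number of $T$. For each positive integer $b$, let $T(2,b)$ be the tree on $2b+1$ vertices with vertex set $\{u_1, \dots, u_b\} \cup \{v\} \cup \{w_1, \dots, w_b\}$ and edge set $\{u_1u_2, \dots, u_1u_b\} \cup \{u_1v, vw_1\} \cup \{w_1w_2, \dots, w_1w_b\}$. Then $$\lim_{b \to \infty} s_9(T(2,b)) = \infty.$$
   Context: Graphs are finite, simple and undirected; $V(G)$ and $E(G)$ denote the vertex and edge sets of $G$, and an edge $\{u,v\}$ is written $uv$. The adjacency matrix of $G$ is the square matrix $A$ indexed by $V(G)$ with $A(u,v) = 1$ if $u$ is adjacent to $v$ and $A(u,v) = 0$ otherwise. The independence number $\alpha(G)$ is the maximum size of a set of pairwise nonadjacent vertices of $G$. In the definition of $T(2,b)$ the $2b+1$ named vertices are pairwise distinct; $T(2,b)$ is the tree obtained by joining the centers of two copies of the star on $b$ vertices to a new vertex $v$. *)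

theory Defs
  imports
    Complex_Main
    "HOL-Library.Countable_Set"
    "Graph_Theory.Graph_Theory"
    "Jordan_Normal_Form.Char_Poly"
begin

text \<open>
  Finite simple undirected graphs are modelled as in \<^theory>\<open>Graph_Theory.Graph_Theory\<close>, by finite
  symmetric loop-free digraphs without parallel arcs (\<^locale>\<open>pair_graph\<close>): an edge \<open>uv\<close> is
  represented by the two arcs \<open>(u, v)\<close> and \<open>(v, u)\<close>.

  The definition below replaces the constant \<open>tree\<close> of that theory, whose cycles include the
  closed walks \<open>u, v, u\<close>, so that no symmetric digraph with an edge is a \<open>tree\<close> there.
\<close>

definition undirected_tree :: "'a pair_pre_digraph \<Rightarrow> bool" where
  "undirected_tree T \<longleftrightarrow>
     pair_graph T \<and> connected T \<and> \<not> (\<exists>p. pre_digraph.cycle (with_proj T) p \<and> length p \<ge> 3)"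

text \<open>
  Library matrices are indexed by natural numbers, so the vertices are enumerated by
  \<^const>\<open>from_nat_into\<close>, which for a finite set \<open>V\<close> is a bijection from \<open>{..<card V}\<close> to \<open>V\<close>.
  Another enumeration would conjugate the matrix by a permutation matrix.
\<close>

definition adjacency_matrix :: "'a pair_pre_digraph \<Rightarrow> real mat" where
  "adjacency_matrix G =
     mat (card (pverts G)) (card (pverts G))
       (\<lambda>(i, j). if (from_nat_into (pverts G) i, from_nat_into (pverts G) j) \<in> parcs G
                 then 1 else 0)"

definition largest_eigenvalue :: "'a pair_pre_digraph \<Rightarrow> real" where
  "largest_eigenvalue G = Max {k. eigenvalue (adjacency_matrix G) k}"

definition independent_set :: "'a pair_pre_digraph \<Rightarrow> 'a set \<Rightarrow> bool" where
  "independent_set G S \<longleftrightarrow> S \<subseteq> pverts G \<and> (\<forall>u\<in>S. \<forall>v\<in>S. (u, v) \<notin> parcs G)"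

definition independence_number :: "'a pair_pre_digraph \<Rightarrow> nat" where
  "independence_number G = Max (card ` {S. independent_set G S})"

definition s9 :: "'a pair_pre_digraph \<Rightarrow> real" where
  "s9 T = (let n = real (card (pverts T)) in
     sqrt (n - 1) - n + 1 - largest_eigenvalue T + real (independence_number T))"

datatype vertex = U nat | V | W nat

definition T2_edges :: "nat \<Rightarrow> (vertex \<times> vertex) set" where
  "T2_edges b = {(U 1, U i) | i. i \<in> {2..b}} \<union> {(U 1, V), (V, W 1)} \<union> {(W 1, W i) | i. i \<in> {2..b}}"

definition T2 :: "nat \<Rightarrow> vertex pair_pre_digraph" where
  "T2 b = \<lparr> pverts = U ` {1..b} \<union> {V} \<union> W ` {1..b}, parcs = T2_edges b \<union> (T2_edges b)\<inverse> \<rparr>"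

lemma card_pverts_T2: "card (pverts (T2 b)) = 2 * b + 1"
proof -
  have "card (U ` {1..b}) = b" "card (W ` {1..b}) = b"
    by (simp_all add: card_image inj_on_def)
  moreover have "card (insert V (U ` {1..b} \<union> W ` {1..b})) = Suc (card (U ` {1..b} \<union> W ` {1..b}))"
    by (rule card_insert_disjoint) auto
  moreover have "card (U ` {1..b} \<union> W ` {1..b}) = card (U ` {1..b}) + card (W ` {1..b})"
    by (rule card_Un_disjoint) auto
  ultimately show ?thesis by (simp add: T2_def)
qed

lemma pair_graph_T2:
  assumes "b \<ge> 1"
  shows "pair_graph (T2 b)"
proof
  have "parcs (T2 b) \<subseteq> pverts (T2 b) \<times> pverts (T2 b)"
    using assms by (auto simp: T2_def T2_edges_def)
  then show "fst e \<in> pverts (T2 b)" "snd e \<in> pverts (T2 b)" if "e \<in> parcs (T2 b)" for e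
    using that by auto
  show fin: "finite (pverts (T2 b))" by (simp add: T2_def)
  show "finite (parcs (T2 b))"
    using \<open>parcs (T2 b) \<subseteq> _\<close> fin by (meson finite_SigmaI finite_subset)
  show "symmetric (with_proj (T2 b))"
    by (auto simp: symmetric_def sym_def T2_def)
  show "fst e \<noteq> snd e" if "e \<in> parcs (T2 b)" for e
    using that by (auto simp: T2_def T2_edges_def)
qed

lemma connected_T2:
  assumes "b \<ge> 1"
  shows "connected (T2 b)"
proof -
  interpret pair_graph "T2 b" using assms by (rule pair_graph_T2)
  have arc: "u \<rightarrow>\<^sup>*\<^bsub>with_proj (T2 b)\<^esub> v" if "(u, v) \<in> parcs (T2 b)" for u v
    using that by (intro reachable_adjI) simp
  have toV: "x \<rightarrow>\<^sup>*\<^bsub>with_proj (T2 b)\<^esub> V" if "x \<in> pverts (T2 b)" for x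
  proof -
    have u: "U 1 \<rightarrow>\<^sup>*\<^bsub>with_proj (T2 b)\<^esub> V" and w: "W 1 \<rightarrow>\<^sup>*\<^bsub>with_proj (T2 b)\<^esub> V"
      by (rule arc; simp add: T2_def T2_edges_def)+
    from that consider "x = V" | "x = U 1" | "x = W 1"
      | i where "x = U i" "i \<in> {2..b}" | i where "x = W i" "i \<in> {2..b}"
      by (force simp: T2_def)
    then show ?thesis
    proof cases
      case 1 then show ?thesis using that by simp
    next
      case 4
      then have "x \<rightarrow>\<^sup>*\<^bsub>with_proj (T2 b)\<^esub> U 1"
        by (intro arc) (auto simp: T2_def T2_edges_def)
      then show ?thesis using u by (rule reachable_trans)
    next
      case 5
      then have "x \<rightarrow>\<^sup>*\<^bsub>with_proj (T2 b)\<^esub> W 1"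
        by (intro arc) (auto simp: T2_def T2_edges_def)
      then show ?thesis using w by (rule reachable_trans)
    qed (use u w in simp_all)
  qed
  have fromV: "V \<rightarrow>\<^sup>*\<^bsub>with_proj (T2 b)\<^esub> x" if "x \<in> pverts (T2 b)" for x
    using toV[OF that] symmetric_reachable[OF sym_arcs] by blast
  have "strongly_connected (with_proj (T2 b))"
    unfolding strongly_connected_def
  proof (intro conjI ballI)
    show "verts (with_proj (T2 b)) \<noteq> {}" by (simp add: T2_def)
    show "x \<rightarrow>\<^sup>*\<^bsub>with_proj (T2 b)\<^esub> y"
      if "x \<in> verts (with_proj (T2 b))" "y \<in> verts (with_proj (T2 b))" for x y
      using toV[of x] fromV[of y] that by (auto intro: reachable_trans[of x V y])
  qed
  moreover have "mk_symmetric (T2 b) = T2 b"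
  proof -
    have "sym (parcs (T2 b))" by (auto simp: sym_def T2_def)
    then have "(\<Union>e\<in>parcs (T2 b). {(fst e, snd e), (snd e, fst e)}) = parcs (T2 b)"
      by (auto dest: symD)
    then show ?thesis by (simp add: mk_symmetric_def)
  qed
  ultimately show ?thesis by (simp add: connected_def)
qed

lemma parent_T2:
  obtains d :: "vertex \<Rightarrow> nat" and par where
    "\<And>x y. (x, y) \<in> parcs (T2 b) \<Longrightarrow> d y \<le> d x \<Longrightarrow> y = par x"
proof
  define d :: "vertex \<Rightarrow> nat" where "d x = (case x of V \<Rightarrow> 0 | U i \<Rightarrow> if i = 1 then 1 else 2 | W i \<Rightarrow> if i = 1 then 1 else 2)"
    for x :: vertex
  define par where "par x = (case x of V \<Rightarrow> V | U i \<Rightarrow> if i = 1 then V else U 1 | W i \<Rightarrow> if i = 1 then V else W 1)"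
    for x :: vertex
  show "y = par x" if "(x, y) \<in> parcs (T2 b)" "d y \<le> d x" for x y
    using that by (auto simp: T2_def T2_edges_def d_def par_def)
qed

lemma pawalk_verts_arcs:
  assumes "pcas u p v"
  shows "length (pawalk_verts u p) = Suc (length p)"
    and "pawalk_verts u p ! 0 = u"
    and "pawalk_verts u p ! length p = v"
    and "i < length p \<Longrightarrow> (pawalk_verts u p ! i, pawalk_verts u p ! Suc i) = p ! i"
proof -
  have nth0: "pawalk_verts w q ! 0 = w" if "pcas w q w'" for w w' :: 'a and q
    using that by (cases q) auto
  show "length (pawalk_verts u p) = Suc (length p)" by (induct p arbitrary: u) auto
  show "pawalk_verts u p ! 0 = u" using assms by (rule nth0)
  show "pawalk_verts u p ! length p = v"
    using assms by (induct p arbitrary: u) auto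
  show "(pawalk_verts u p ! i, pawalk_verts u p ! Suc i) = p ! i" if "i < length p"
    using assms that by (induct p arbitrary: u i) (auto simp: nth0 less_Suc_eq_0_disj)
qed

lemma acyclic_T2:
  assumes cyc: "pre_digraph.cycle (with_proj (T2 b)) p" and len: "length p \<ge> 3"
  shows False
proof -
  interpret pair_pre_digraph "T2 b" .
  obtain u where "awalk u p u" and dist: "distinct (tl (pawalk_verts u p))"
    using cyc by (auto simp: cycle_def)
  then have cas: "pcas u p u" and sub: "set p \<subseteq> parcs (T2 b)" by (auto simp: awalk_def)
  define x where "x i = pawalk_verts u p ! i" for i
  define k where "k = length p"
  note pv = pawalk_verts_arcs[OF cas]
  have k3: "k \<ge> 3" and x0: "x 0 = x k" using len pv by (auto simp: x_def k_def)
  have arc: "(x i, x (Suc i)) \<in> parcs (T2 b)" if "i < k" for i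
    using pv(4)[of i] sub that by (auto simp: x_def k_def)
  have sym: "(v, w) \<in> parcs (T2 b)" if "(w, v) \<in> parcs (T2 b)" for v w
    using that by (auto simp: T2_def)
  have inj: "i = j" if "x i = x j" "1 \<le> i" "i \<le> k" "1 \<le> j" "j \<le> k" for i j
  proof -
    have "tl (pawalk_verts u p) ! (i - 1) = tl (pawalk_verts u p) ! (j - 1)"
      using that pv(1) by (simp add: nth_tl x_def k_def)
    then have "i - 1 = j - 1"
      using nth_eq_iff_index_eq[OF dist] that pv(1) by (simp add: k_def)
    then show ?thesis using that by simp
  qed
  obtain d :: "vertex \<Rightarrow> nat" and par where
    par: "\<And>v w. (v, w) \<in> parcs (T2 b) \<Longrightarrow> d w \<le> d v \<Longrightarrow> w = par v"
    using parent_T2 by blast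
  obtain i where i: "i \<in> {1..k}" and max: "\<And>j. j \<in> {1..k} \<Longrightarrow> d (x j) \<le> d (x i)"
  proof -
    let ?D = "(\<lambda>j. d (x j)) ` {1..k}"
    have "Max ?D \<in> ?D" using k3 by (intro Max_in) auto
    then obtain i where "i \<in> {1..k}" "Max ?D = d (x i)" by blast
    moreover have "d (x j) \<le> Max ?D" if "j \<in> {1..k}" for j
      using that by (intro Max_ge) auto
    ultimately show thesis using that by metis
  qed
  have max': "d (x j) \<le> d (x i)" if "j \<le> k" for j
    using max[of j] max[of k] x0 k3 that by (cases "j = 0") auto
  define j where "j = (if i = k then 1 else Suc i)"
  have prev: "x (i - 1) = par (x i)"
    using sym[OF arc[of "i - 1"]] i by (intro par[of "x i"] max') auto
  have "(x i, x j) \<in> parcs (T2 b)"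
    using arc[of i] arc[of 0] i x0 k3 by (auto simp: j_def)
  then have "x j = par (x i)"
    using i k3 by (intro par[of "x i"] max') (auto simp: j_def)
  then have eq: "x (i - 1) = x j" using prev by simp
  show False
  proof (cases "i = 1")
    case True
    then have "x k = x 2" using eq x0 k3 by (simp add: j_def numeral_2_eq_2)
    then show False using inj[of k 2] k3 by simp
  next
    case False
    then have "i - 1 = j" using i k3 by (intro inj[OF eq]) (auto simp: j_def)
    then show False using i k3 by (cases "i = k") (auto simp: j_def)
  qed
qed

theorem undirected_tree_T2: "b \<ge> 1 \<Longrightarrow> undirected_tree (T2 b)"
  using pair_graph_T2 connected_T2 acyclic_T2 by (auto simp: undirected_tree_def)

end

theory Submission
  imports Defs "HOL-Real_Asymp.Real_Asymp"
begin

text \<open>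
  The weights \<open>\<surd>(b + 1)\<close> at \<open>u\<^sub>1, w\<^sub>1\<close>, \<open>2\<close> at \<open>v\<close> and \<open>1\<close> at the leaves form a positive
  eigenvector of \<open>T(2,b)\<close>, so the largest eigenvalue is \<open>\<surd>(b + 1)\<close>. The leaves
  together with \<open>v\<close> are \<open>2b - 1\<close> independent vertices. Hence
  \<open>s\<^sub>9(T(2,b)) \<ge> \<surd>(2b) - \<surd>(b + 1) - 1\<close>, which tends to infinity because \<open>\<surd>2 > 1\<close>.
\<close>

text \<open>The adjacency operator acting on functions on the vertices, which does not depend on how
  \<open>adjacency_matrix\<close> enumerates them.\<close>

definition neighbour_sum :: "'a pair_pre_digraph \<Rightarrow> ('a \<Rightarrow> real) \<Rightarrow> 'a \<Rightarrow> real" where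
  "neighbour_sum G x u = (\<Sum>v | v \<in> pverts G \<and> (u, v) \<in> parcs G. x v)"

text \<open>The enumeration is a bijection onto the vertices, so each row sum over indices becomes a
  sum over vertices, of which the 0/1 entries keep the neighbours.\<close>

lemma adjacency_matrix_mult_vec:
  assumes "finite (pverts G)"
  shows "adjacency_matrix G *\<^sub>v vec (card (pverts G)) (\<lambda>i. x (from_nat_into (pverts G) i)) =
    vec (card (pverts G)) (\<lambda>i. neighbour_sum G x (from_nat_into (pverts G) i))"
proof (rule eq_vecI)
  let ?n = "card (pverts G)" and ?e = "from_nat_into (pverts G)"
  fix i assume "i < dim_vec (vec ?n (\<lambda>i. neighbour_sum G x (?e i)))"
  then have i: "i < ?n" by simp
  have bij: "bij_betw ?e {..<?n} (pverts G)"
    using assms by (rule bij_betw_from_nat_into_finite)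
  have "(adjacency_matrix G *\<^sub>v vec ?n (\<lambda>i. x (?e i))) $ i =
      (\<Sum>j<?n. (if (?e i, ?e j) \<in> parcs G then 1 else 0) * x (?e j))"
    using i by (simp add: adjacency_matrix_def scalar_prod_def atLeast0LessThan)
  also have "\<dots> = (\<Sum>v\<in>pverts G. (if (?e i, v) \<in> parcs G then 1 else 0) * x v)"
    by (rule sum.reindex_bij_betw[OF bij])
  also have "\<dots> = neighbour_sum G x (?e i)"
    unfolding neighbour_sum_def using assms by (intro sum.mono_neutral_cong_right) auto
  finally show "(adjacency_matrix G *\<^sub>v vec ?n (\<lambda>i. x (?e i))) $ i =
      vec ?n (\<lambda>i. neighbour_sum G x (?e i)) $ i"
    using i by simp
qed (simp add: adjacency_matrix_def)

text \<open>Frees spectral arguments from matrix indices: along the enumeration, every vector of the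
  right dimension comes from a function on the vertices.\<close>

lemma eigenvalue_adjacency_matrix_iff:
  assumes fin: "finite (pverts G)"
  shows "eigenvalue (adjacency_matrix G) k \<longleftrightarrow>
    (\<exists>x. (\<exists>u\<in>pverts G. x u \<noteq> 0) \<and> (\<forall>u\<in>pverts G. neighbour_sum G x u = k * x u))"
    (is "?L \<longleftrightarrow> (\<exists>x. ?R x)")
proof -
  let ?n = "card (pverts G)" and ?e = "from_nat_into (pverts G)"
  have bij: "bij_betw ?e {..<?n} (pverts G)"
    using fin by (rule bij_betw_from_nat_into_finite)
  have img: "pverts G = ?e ` {..<?n}" using bij by (simp add: bij_betw_def)
  have key: "eigenvector (adjacency_matrix G) (vec ?n (\<lambda>i. x (?e i))) k \<longleftrightarrow> ?R x" for x
  proof -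
    have "eigenvector (adjacency_matrix G) (vec ?n (\<lambda>i. x (?e i))) k \<longleftrightarrow>
      (\<exists>i<?n. x (?e i) \<noteq> 0) \<and> (\<forall>i<?n. neighbour_sum G x (?e i) = k * x (?e i))"
      unfolding eigenvector_def adjacency_matrix_mult_vec[OF fin]
      by (auto simp: adjacency_matrix_def vec_eq_iff)
    also have "\<dots> \<longleftrightarrow> ?R x"
      by (subst (1 2) img) auto
    finally show ?thesis .
  qed
  have surj: "\<exists>x. y = vec ?n (\<lambda>i. x (?e i))" if "y \<in> carrier_vec ?n" for y :: "real vec"
  proof
    \<comment> \<open>The function reads off the entry of \<open>y\<close> at the index of a
      vertex.\<close>
    show "y = vec ?n (\<lambda>i. y $ the_inv_into {..<?n} ?e (?e i))"
      using that bij by (intro eq_vecI) (auto simp: bij_betw_def the_inv_into_f_f)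
  qed
  have "?L \<longleftrightarrow> (\<exists>x. eigenvector (adjacency_matrix G) (vec ?n (\<lambda>i. x (?e i))) k)"
  proof
    assume ?L
    then obtain y where y: "eigenvector (adjacency_matrix G) y k" by (auto simp: eigenvalue_def)
    then have "y \<in> carrier_vec ?n" by (simp add: eigenvector_def adjacency_matrix_def)
    then obtain x where "y = vec ?n (\<lambda>i. x (?e i))" using surj by blast
    with y show "\<exists>x. eigenvector (adjacency_matrix G) (vec ?n (\<lambda>i. x (?e i))) k" by blast
  qed (auto simp: eigenvalue_def)
  then show ?thesis unfolding key .
qed

text \<open>Eigenvalues are roots of the characteristic polynomial, which is monic and hence
  nonzero. Finiteness makes the \<open>Max\<close> in \<open>largest_eigenvalue\<close> a true
  maximum.\<close>

lemma finite_eigenvalues: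
  fixes A :: "'a :: field mat"
  assumes A: "A \<in> carrier_mat n n"
  shows "finite {k. eigenvalue A k}"
proof -
  have "char_poly A \<noteq> 0" using degree_monic_char_poly[OF A] by auto
  then show ?thesis
    unfolding eigenvalue_root_char_poly[OF A] by (rule poly_roots_finite)
qed

text \<open>If \<open>x\<close> is an eigenvector for \<open>k\<close>, compare both sides at a vertex maximizing \<open>\<bar>x\<bar> / h\<close>.\<close>

lemma largest_eigenvalue_eqI:
  assumes fin: "finite (pverts G)" and ne: "pverts G \<noteq> {}"
    and pos: "\<And>u. u \<in> pverts G \<Longrightarrow> h u > 0"
    and eig: "\<And>u. u \<in> pverts G \<Longrightarrow> neighbour_sum G h u = \<mu> * h u"
  shows "largest_eigenvalue G = \<mu>"
  unfolding largest_eigenvalue_def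
proof (rule Max_eqI)
  show "finite {k. eigenvalue (adjacency_matrix G) k}"
    by (rule finite_eigenvalues[of _ "card (pverts G)"]) (simp add: adjacency_matrix_def)
  show "\<mu> \<in> {k. eigenvalue (adjacency_matrix G) k}"
    unfolding mem_Collect_eq eigenvalue_adjacency_matrix_iff[OF fin]
  proof (intro exI[of _ h] conjI ballI eig)
    show "\<exists>u\<in>pverts G. h u \<noteq> 0" using ne pos by (metis ex_in_conv less_irrefl)
  qed
  fix k assume "k \<in> {k. eigenvalue (adjacency_matrix G) k}"
  then obtain x where x: "\<exists>u\<in>pverts G. x u \<noteq> 0"
    and xk: "\<And>u. u \<in> pverts G \<Longrightarrow> neighbour_sum G x u = k * x u"
    by (auto simp: eigenvalue_adjacency_matrix_iff[OF fin])
  define r where "r v = \<bar>x v\<bar> / h v" for v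
  have "Max (r ` pverts G) \<in> r ` pverts G"
    using fin ne by (intro Max_in) auto
  then obtain u where u: "u \<in> pverts G" and "r u = Max (r ` pverts G)" by force
  then have max: "r v \<le> r u" if "v \<in> pverts G" for v
    using fin that by simp
  have abs_x: "\<bar>x v\<bar> = r v * h v" if "v \<in> pverts G" for v
    using pos[OF that] by (simp add: r_def)
  obtain v where v: "v \<in> pverts G" "x v \<noteq> 0" using x by blast
  then have "r v > 0" using pos by (simp add: r_def)
  \<comment> \<open>The maximal ratio is at least \<open>r v > 0\<close>. This strict inequality
    allows cancelling \<bar>x u\<bar> at the end.\<close>
  then have "\<bar>x u\<bar> > 0" using max[OF v(1)] pos[OF u] abs_x[OF u] by simp
  have "k * \<bar>x u\<bar> \<le> \<bar>neighbour_sum G x u\<bar>"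
    using xk[OF u] by (simp add: abs_mult mult_right_mono)
  also have "\<dots> \<le> (\<Sum>v | v \<in> pverts G \<and> (u, v) \<in> parcs G. \<bar>x v\<bar>)"
    unfolding neighbour_sum_def by (rule sum_abs)
  also have "\<dots> \<le> (\<Sum>v | v \<in> pverts G \<and> (u, v) \<in> parcs G. r u * h v)"
    using max pos by (intro sum_mono) (auto simp: abs_x intro!: mult_right_mono less_imp_le)
  \<comment> \<open>Pulling out \<open>r u\<close> leaves the neighbour sum of \<open>h\<close> at
    \<open>u\<close>, which is \<open>\<mu> * h u\<close>.\<close>
  also have "\<dots> = \<mu> * \<bar>x u\<bar>"
    using eig[OF u] abs_x[OF u] by (simp add: neighbour_sum_def flip: sum_distrib_left)
  finally show "k \<le> \<mu>" using \<open>\<bar>x u\<bar> > 0\<close> by simp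
qed

lemma largest_eigenvalue_T2:
  assumes "b \<ge> 1"
  shows "largest_eigenvalue (T2 b) = sqrt (real b + 1)"
proof -
  define \<mu> where "\<mu> = sqrt (real b + 1)"
  have sq: "\<mu> * \<mu> = real b + 1" and "\<mu> > 0" by (simp_all add: \<mu>_def)
  define h where "h u = (case u of U i \<Rightarrow> if i = 1 then \<mu> else 1 | V \<Rightarrow> 2
    | W i \<Rightarrow> if i = 1 then \<mu> else 1)" for u
  have nbh: "{v. v \<in> pverts (T2 b) \<and> (u, v) \<in> parcs (T2 b)} =
      (case u of U i \<Rightarrow> if i = 1 then insert V (U ` {2..b}) else {U 1}
        | V \<Rightarrow> {U 1, W 1} | W i \<Rightarrow> if i = 1 then insert V (W ` {2..b}) else {W 1})"
    if "u \<in> pverts (T2 b)" for u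
    using assms that by (auto simp: T2_def T2_edges_def split: vertex.splits)
  have leaves: "(\<Sum>v\<in>U ` {2..b}. h v) = real b - 1" "(\<Sum>v\<in>W ` {2..b}. h v) = real b - 1"
    using assms by (simp_all add: sum.reindex inj_on_def h_def)
  \<comment> \<open>At a star center, the \<open>b - 1\<close> leaves of weight 1 and
    \<open>V\<close> of weight 2 add up to \<open>b + 1\<close>, which fixes the choice of \<mu>.
    The weight 2 is forced at \<open>V\<close>, whose two neighbours have weight \<mu>.\<close>
  have centre: "sum h (insert V (U ` {2..b})) = \<mu> * \<mu>" "sum h (insert V (W ` {2..b})) = \<mu> * \<mu>"
  proof -
    have "h V = 2" by (simp add: h_def)
    moreover have "V \<notin> U ` {2..b}" "V \<notin> W ` {2..b}" by auto
    ultimately show "sum h (insert V (U ` {2..b})) = \<mu> * \<mu>"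
      "sum h (insert V (W ` {2..b})) = \<mu> * \<mu>"
      by (simp_all add: leaves sq)
  qed
  have "largest_eigenvalue (T2 b) = \<mu>"
  proof (rule largest_eigenvalue_eqI)
    show "h u > 0" for u
      using \<open>\<mu> > 0\<close> by (simp add: h_def split: vertex.split)
    show "neighbour_sum (T2 b) h u = \<mu> * h u" if "u \<in> pverts (T2 b)" for u
      unfolding neighbour_sum_def nbh[OF that]
      using centre by (cases u) (simp_all add: h_def)
  qed (simp_all add: T2_def)
  then show ?thesis by (simp add: \<mu>_def)
qed

lemma independence_number_T2_ge: "independence_number (T2 b) \<ge> 2 * b - 1"
proof -
  let ?L = "insert V (U ` {2..b} \<union> W ` {2..b})"
  have "card ?L = Suc (card (U ` {2..b} \<union> W ` {2..b}))"
    by (rule card_insert_disjoint) auto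
  also have "card (U ` {2..b} \<union> W ` {2..b}) = card (U ` {2..b}) + card (W ` {2..b})"
    by (rule card_Un_disjoint) auto
  also have "\<dots> = (b - 1) + (b - 1)" by (simp add: card_image inj_on_def)
  \<comment> \<open>For \<open>b = 0\<close> the truncated subtraction gives 0, while the set is
    still \<open>{V}\<close>; hence an inequality.\<close>
  finally have card: "2 * b - 1 \<le> card ?L" by simp
  have ind: "independent_set (T2 b) ?L"
    by (auto simp: independent_set_def T2_def T2_edges_def)
  have "finite {S. independent_set (T2 b) S}"
    by (rule finite_subset[of _ "Pow (pverts (T2 b))"]) (auto simp: independent_set_def T2_def)
  then have "card ?L \<le> independence_number (T2 b)"
    unfolding independence_number_def using ind by (intro Max_ge) auto
  with card show ?thesis by simp
qed

text \<open>With \<open>n = 2 * b + 1\<close>, the term \<open>- n + 1\<close> is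
  \<open>- 2 * b\<close>, so adding the bound \<open>2 * b - 1\<close> on the independence number
  leaves only the constant \<open>- 1\<close>.\<close>

lemma s9_T2_ge:
  assumes "b \<ge> 1"
  shows "s9 (T2 b) \<ge> sqrt (2 * real b) - sqrt (real b + 1) - 1"
proof -
  have "real (independence_number (T2 b)) \<ge> 2 * real b - 1"
    using independence_number_T2_ge[of b] assms by linarith
  then show ?thesis
    using assms by (simp add: s9_def card_pverts_T2 largest_eigenvalue_T2 Let_def)
qed

theorem theorem3:
  shows "filterlim (\<lambda>b. s9 (T2 b)) at_top sequentially"
proof (rule filterlim_at_top_mono)
  show "filterlim (\<lambda>b. sqrt (2 * real b) - sqrt (real b + 1) - 1) at_top sequentially"
    by real_asymp
  show "\<forall>\<^sub>F b in sequentially. sqrt (2 * real b) - sqrt (real b + 1) - 1 \<le> s9 (T2 b)"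
    using eventually_ge_at_top[of 1] by eventually_elim (rule s9_T2_ge)
qed

end
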